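(* Consider each $D_e$ as the corresponding distribution of a particular training domain (environment) $e$. For any $\beta\cdot\Phi$ as a deep network with any activation function, the penalty term of IRMv1, $$\mathrm{Penalty_{IRM}}=\bigl\|\nabla_{w|w=1.0}\,R^e(w\cdot(\beta\cdot\Phi))\bigr\|^2,$$ can be expressed as the square of a reweighted version of the penalty term of the approximate (linearized) domain-wise adversarial training objective, $$\mathrm{Penalty_{DAT}}=\bigl\|\mathbb{E}_{(x,y)\sim D_e}\nabla_x\,\ell(\beta^\top\Phi(x),y)\bigr\|,$$ on each environment $e$, with coefficients related to the distribution $D_e$. This is stated as follows: $$\mathrm{Penalty_{IRM}}=\bigl\|\mathbb{E}_{D_e}[L_x x+\tilde B_x]\bigr\|^2,\qquad \mathrm{Penalty_{DAT}}=\bigl\|\mathbb{E}_{D_e}L_x\bigr\|,$$ where $$L_x=\bigl(1-\sigma(y\beta^\top\Phi_x x)\bigr)\,y\,\beta^\top\Phi_x,\qquad \tilde B_x=\bigl(1-\sigma(y\beta^\top\Phi_x x)\bigr)\,y\,\beta^\top B_x,$$ and $B_x$ denotes the collection of constants introduced by the bias terms in the neural network layers.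
   Context: The setting is binary classification with labels $y\in\{\pm1\}$. The representation $\Phi:\mathcal X\subset\mathbb{R}^n\to\mathbb{R}^d$ is a feed-forward network built from layer-wise weight matrices, bias vectors and activation functions; $\beta$ is a linear classifier on top of it, and the network output is $\beta\cdot\Phi(x)=\beta^\top\Phi(x)$ (output dimension $d=1$ is considered). The network is taken to be piecewise linear, and at a sample $x$ the output logit is written $\beta^\top\Phi(x)=\beta^\top(\Phi_x x+B_x)$, where the matrix $\Phi_x$ and the constant $B_x$ depend on $x$ through the activation pattern at $x$. $\sigma$ is the sigmoid function, and $\ell(\hat y,y)=-\log\sigma(y\hat y)$ is the logistic loss. There is a set $\mathcal E$ of training environments; each $e\in\mathcal E$ has a data distribution $D_e$ on pairs $(x,y)$, and $\mathbb{E}_{D_e}$ is expectation over $(x,y)\sim D_e$. The risk on environment $e$ is $R^e(\beta\cdot\Phi)=\mathbb{E}_{(x,y)\sim D_e}\ell(\beta^\top\Phi(x),y)$, and for a scalar dummy variable $w$, $R^e(w\cdot(\beta\cdot\Phi))=\mathbb{E}_{(x,y)\sim D_e}\ell(w\,\beta^\top\Phi(x),y)$; $\nabla_{w|w=1.0}$ is the derivative in $w$ evaluated at $w=1$. The IRMv1 (practical Invariant Risk Minimization) objective, with regularization weight $\lambda$, is $\min_{\beta,\Phi}\sum_{e\in\mathcal E}[R^e(\beta\cdot\Phi)+\lambda\,\mathrm{Penalty_{IRM}}]$. The domain-wise adversarial training (DAT) objective is $\sum_{e\in\mathcal E}\max_{\|\delta_e\|\le\varepsilon}\mathbb{E}_{(x,y)\sim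 D_e}\ell(\beta^\top\Phi(x+\delta_e),y)$, with one perturbation $\delta_e$ per environment and radius $\varepsilon$; its first-order approximation is $\sum_{e\in\mathcal E}[R^e(\beta\cdot\Phi)+\varepsilon\,\mathrm{Penalty_{DAT}}]$.
   Formalization: The sigmoid in L_x and B̃_x is taken at the full logit yβᵀ(Φ_x x+B_x), since the display without B_x is false; B_x also holds activation intercepts; samples are a.s. off kinks, activations and slopes Borel, the risk finite for w near 1 and the loss gradient integrable. *)

theory Defs
  imports "HOL-Probability.Probability"
begin

definition sigmoid :: "real \<Rightarrow> real" where
  "sigmoid t = 1 / (1 + exp (- t))"

definition logistic_loss :: "real \<Rightarrow> real \<Rightarrow> real" where
  "logistic_loss yhat y = - ln (sigmoid (y * yhat))"

text \<open>The library has the relation \<open>GDERIV f x :> D\<close> but no gradient function.\<close>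

definition gradient :: "('a::real_inner \<Rightarrow> real) \<Rightarrow> 'a \<Rightarrow> 'a" where
  "gradient f x = (THE D. GDERIV f x :> D)"


subsection \<open>Feed-forward networks\<close>

text \<open>
  Layers are numbered \<open>0, \<dots>, depth\<close>; the neurons of layer \<open>l\<close> are the \<open>i < width l\<close>, so that
  hidden layers may have different widths, and values at indices outside these ranges play no role.
  Row \<open>i\<close> of the weight matrix of layer \<open>0\<close> is the vector \<open>in_weight i\<close> of the input space, and
  \<open>weight l i j\<close> is the weight from neuron \<open>j\<close> of layer \<open>l\<close> to neuron \<open>i\<close> of layer \<open>l + 1\<close>.
  The representation is the output of layer \<open>depth\<close>, and \<open>d = width depth\<close>.  A last layer without
  activation is the case \<open>act depth = (\<lambda>t. t)\<close>.
\<close>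

record 'n network =
  depth :: nat
  width :: "nat \<Rightarrow> nat"
  in_weight :: "nat \<Rightarrow> real ^ 'n"
  weight :: "nat \<Rightarrow> nat \<Rightarrow> nat \<Rightarrow> real"
  bias :: "nat \<Rightarrow> nat \<Rightarrow> real"
  act :: "nat \<Rightarrow> real \<Rightarrow> real"

primrec preact :: "('n::finite) network \<Rightarrow> nat \<Rightarrow> real ^ 'n \<Rightarrow> nat \<Rightarrow> real" where
  "preact N 0 x i = in_weight N i \<bullet> x + bias N 0 i"
| "preact N (Suc l) x i =
     (\<Sum>j<width N l. weight N l i j * act N l (preact N l x j)) + bias N (Suc l) i"

definition rep :: "('n::finite) network \<Rightarrow> real ^ 'n \<Rightarrow> nat \<Rightarrow> real" where
  "rep N x i = act N (depth N) (preact N (depth N) x i)"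

definition logit :: "('n::finite) network \<Rightarrow> (nat \<Rightarrow> real) \<Rightarrow> real ^ 'n \<Rightarrow> real" where
  "logit N \<beta> x = (\<Sum>i<width N (depth N). \<beta> i * rep N x i)"


subsection \<open>Activation pattern and the affine form of the network at a sample\<close>

text \<open>
  \<open>s l t\<close> is the slope of the affine piece of the activation function \<open>act l\<close> that is active at the
  pre-activation \<open>t\<close>.  It is the derivative wherever there is one; at a kink (e.g. at \<open>0\<close> for ReLU)
  any convention is allowed.  For a piecewise linear activation this is the slope of the piece that
  contains \<open>t\<close>; for a smooth one the active piece is the tangent at \<open>t\<close>.
\<close>

definition activation_slopes :: "('n::finite) network \<Rightarrow> (nat \<Rightarrow> real \<Rightarrow> real) \<Rightarrow> bool" where
  "activation_slopes N s \<longleftrightarrow>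
     (\<forall>l\<le>depth N. \<forall>t D. (act N l has_real_derivative D) (at t) \<longrightarrow> s l t = D)"

text \<open>
  The constant term of the active piece, i.e. \<open>act l t = s l t * t + icpt l t\<close>.  It vanishes for
  ReLU-type activations (and identity), where all constants below come from the biases.
\<close>

definition icpt :: "('n::finite) network \<Rightarrow> (nat \<Rightarrow> real \<Rightarrow> real) \<Rightarrow> nat \<Rightarrow> real \<Rightarrow> real" where
  "icpt N s l t = act N l t - s l t * t"

text \<open>
  With the pieces that are active at \<open>x\<close>, the pre-activations of layer \<open>l\<close> are the affine map with
  rows \<open>pre_mat N s l x i\<close> and constants \<open>pre_const N s l x i\<close>; \<open>rep_mat\<close> is the matrix
  \<open>\<Phi>\<^sub>x\<close> (row \<open>i\<close> as a vector of the input space) and \<open>rep_const\<close> is \<open>B\<^sub>x\<close>.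
\<close>

primrec pre_mat ::
  "('n::finite) network \<Rightarrow> (nat \<Rightarrow> real \<Rightarrow> real) \<Rightarrow> nat \<Rightarrow> real ^ 'n \<Rightarrow> nat \<Rightarrow> real ^ 'n" where
  "pre_mat N s 0 x i = in_weight N i"
| "pre_mat N s (Suc l) x i =
     (\<Sum>j<width N l. (weight N l i j * s l (preact N l x j)) *\<^sub>R pre_mat N s l x j)"

primrec pre_const ::
  "('n::finite) network \<Rightarrow> (nat \<Rightarrow> real \<Rightarrow> real) \<Rightarrow> nat \<Rightarrow> real ^ 'n \<Rightarrow> nat \<Rightarrow> real" where
  "pre_const N s 0 x i = bias N 0 i"
| "pre_const N s (Suc l) x i =
     (\<Sum>j<width N l. weight N l i j *
        (s l (preact N l x j) * pre_const N s l x j + icpt N s l (preact N l x j)))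
     + bias N (Suc l) i"

definition rep_mat ::
  "('n::finite) network \<Rightarrow> (nat \<Rightarrow> real \<Rightarrow> real) \<Rightarrow> real ^ 'n \<Rightarrow> nat \<Rightarrow> real ^ 'n" where
  "rep_mat N s x i =
     s (depth N) (preact N (depth N) x i) *\<^sub>R pre_mat N s (depth N) x i"

definition rep_const ::
  "('n::finite) network \<Rightarrow> (nat \<Rightarrow> real \<Rightarrow> real) \<Rightarrow> real ^ 'n \<Rightarrow> nat \<Rightarrow> real" where
  "rep_const N s x i =
     s (depth N) (preact N (depth N) x i) * pre_const N s (depth N) x i
     + icpt N s (depth N) (preact N (depth N) x i)"

definition logit_row ::
  "('n::finite) network \<Rightarrow> (nat \<Rightarrow> real \<Rightarrow> real) \<Rightarrow> (nat \<Rightarrow> real) \<Rightarrow> real ^ 'n \<Rightarrow> real ^ 'n" where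
  "logit_row N s \<beta> x = (\<Sum>i<width N (depth N). \<beta> i *\<^sub>R rep_mat N s x i)"

definition logit_const ::
  "('n::finite) network \<Rightarrow> (nat \<Rightarrow> real \<Rightarrow> real) \<Rightarrow> (nat \<Rightarrow> real) \<Rightarrow> real ^ 'n \<Rightarrow> real" where
  "logit_const N s \<beta> x = (\<Sum>i<width N (depth N). \<beta> i * rep_const N s x i)"

lemma preact_affine: "preact N l x i = pre_mat N s l x i \<bullet> x + pre_const N s l x i"
proof (induction l arbitrary: i)
  case (Suc l)
  have "weight N l i j * act N l (preact N l x j) =
      ((weight N l i j * s l (preact N l x j)) *\<^sub>R pre_mat N s l x j) \<bullet> x
      + weight N l i j *
        (s l (preact N l x j) * pre_const N s l x j + icpt N s l (preact N l x j))" for j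
    using Suc.IH[of j] by (simp add: icpt_def algebra_simps)
  then show ?case
    by (simp add: inner_sum_left sum.distrib)
qed simp

lemma rep_affine: "rep N x i = rep_mat N s x i \<bullet> x + rep_const N s x i"
  using preact_affine[of N "depth N" x i s]
  by (simp add: rep_def rep_mat_def rep_const_def icpt_def algebra_simps)

lemma logit_affine: "logit N \<beta> x = logit_row N s \<beta> x \<bullet> x + logit_const N s \<beta> x"
  by (simp add: logit_def logit_row_def logit_const_def rep_affine[of N x _ s]
      inner_sum_left sum.distrib distrib_left)

text \<open>
  \<open>L\<^sub>x\<close> and the constant that goes with it.  The sigmoid is evaluated at the full logit
  \<open>\<beta>\<^sup>T (\<Phi>\<^sub>x x + B\<^sub>x) = \<beta>\<^sup>T \<Phi> x\<close>; writing only \<open>\<beta>\<^sup>T \<Phi>\<^sub>x x\<close> there gives the same thing when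
  \<open>\<beta>\<^sup>T B\<^sub>x = 0\<close> but would make both identities false in general.
\<close>

definition sample_weight ::
  "('n::finite) network \<Rightarrow> (nat \<Rightarrow> real \<Rightarrow> real) \<Rightarrow> (nat \<Rightarrow> real) \<Rightarrow> real ^ 'n \<Rightarrow> real \<Rightarrow> real" where
  "sample_weight N s \<beta> x y =
     1 - sigmoid (y * (logit_row N s \<beta> x \<bullet> x + logit_const N s \<beta> x))"

definition Lvec ::
  "('n::finite) network \<Rightarrow> (nat \<Rightarrow> real \<Rightarrow> real) \<Rightarrow> (nat \<Rightarrow> real) \<Rightarrow> real ^ 'n \<Rightarrow> real \<Rightarrow> real ^ 'n" where
  "Lvec N s \<beta> x y = (sample_weight N s \<beta> x y * y) *\<^sub>R logit_row N s \<beta> x"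

definition Bconst ::
  "('n::finite) network \<Rightarrow> (nat \<Rightarrow> real \<Rightarrow> real) \<Rightarrow> (nat \<Rightarrow> real) \<Rightarrow> real ^ 'n \<Rightarrow> real \<Rightarrow> real" where
  "Bconst N s \<beta> x y = sample_weight N s \<beta> x y * y * logit_const N s \<beta> x"

text \<open>
  Samples that do not sit on a kink of the network: each activation function is differentiable at
  its pre-activation, or the pre-activation does not vary near \<open>x\<close> (e.g. a bias-free ReLU neuron
  all of whose inputs are inactive sits exactly at its kink on an open set of inputs).  For continuous
  piecewise linear activations this holds for Lebesgue-almost every \<open>x\<close>.
\<close>

definition regular_sample :: "('n::finite) network \<Rightarrow> real ^ 'n \<Rightarrow> bool" where
  "regular_sample N x \<longleftrightarrow>
     (\<forall>l\<le>depth N. \<forall>i<width N l.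
        act N l differentiable (at (preact N l x i)) \<or>
        (\<forall>\<^sub>F x' in nhds x. preact N l x' i = preact N l x i))"


subsection \<open>Risk and the two penalties\<close>

definition risk :: "((real ^ ('n::finite)) \<times> real) measure \<Rightarrow> (real ^ 'n \<Rightarrow> real) \<Rightarrow> real" where
  "risk D f = (\<integral>(x, y). logistic_loss (f x) y \<partial>D)"

definition penalty_IRM :: "((real ^ ('n::finite)) \<times> real) measure \<Rightarrow> (real ^ 'n \<Rightarrow> real) \<Rightarrow> real" where
  "penalty_IRM D f = (norm (deriv (\<lambda>w. risk D (\<lambda>x. w * f x)) 1))\<^sup>2"

definition penalty_DAT ::
  "((real ^ ('n::finite)) \<times> real) measure \<Rightarrow> (real ^ 'n \<Rightarrow> real) \<Rightarrow> real" where
  "penalty_DAT D f =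
     norm (\<integral>(x, y). gradient (\<lambda>x'. logistic_loss (f x') y) x \<partial>D)"

end

theory Submission
  imports Defs
begin

text \<open>
  At a regular sample the affine piece active there is tangent to the network: a neuron resting on a
  kink contributes nothing, since its pre-activation is locally constant and its row is therefore
  \<open>0\<close>.  Hence \<open>\<nabla>\<^sub>x \<ell> = - L\<^sub>x\<close>, and the minus sign disappears under the norm.  For
  the IRM penalty, \<open>\<partial>\<^sub>w \<ell> = - (1 - \<sigma>(y f)) y f\<close> at \<open>w = 1\<close>, where the logit is
  \<open>f = \<beta>\<^sup>T (\<Phi>\<^sub>x x + B\<^sub>x)\<close>.  The expectation and the \<open>w\<close>-derivative commute without further
  moment assumptions because the loss is convex in \<open>w\<close>: the difference quotients at \<open>1\<close> lie
  between those at two fixed endpoints, which are integrable.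
\<close>

subsection \<open>Differentiating an integral of convex functions\<close>

text \<open>Slopes of a convex function from the fixed point \<open>c\<close> increase with the
  other endpoint, so the slope to \<open>y\<close> lies between those to \<open>a\<close> and
  \<open>b\<close>. The sum of the two absolute values is a bound free of \<open>y\<close>, as
  dominated convergence requires.\<close>

lemma convex_on_abs_slope_le:
  fixes f :: "real \<Rightarrow> real"
  assumes f: "convex_on {a..b} f" and c: "a < c" "c < b" and y: "a < y" "y < b" "y \<noteq> c"
  shows "\<bar>(f y - f c) / (y - c)\<bar> \<le> \<bar>(f a - f c) / (a - c)\<bar> + \<bar>(f b - f c) / (b - c)\<bar>"
proof -
  have swap: "(f u - f v) / (u - v) = (f v - f u) / (v - u)" for u v
    using minus_divide_divide[of "f u - f v" "u - v"] by simp
  have "(f a - f c) / (a - c) \<le> (f y - f c) / (y - c) \<and>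
      (f y - f c) / (y - c) \<le> (f b - f c) / (b - c)"
  proof (cases "c < y")
    case True
    show ?thesis
      using convex_on_slope_le[OF f, of a y c] convex_on_slope_le[OF f, of c b y]
        True c y swap[of y c] swap[of b c] by auto
  next
    case False
    show ?thesis
      using convex_on_slope_le[OF f, of a c y] convex_on_slope_le[OF f, of y b c]
        False c y swap[of y c] swap[of b c] by auto
  qed
  then show ?thesis by linarith
qed

lemma has_real_derivative_integral_convex:
  fixes F :: "'a \<Rightarrow> real \<Rightarrow> real"
  assumes c: "a < c" "c < b"
    and convex: "\<And>z. convex_on {a..b} (F z)"
    and integrable: "\<And>w. w \<in> {a..b} \<Longrightarrow> integrable M (\<lambda>z. F z w)"
    and deriv: "\<And>z. (F z has_real_derivative F' z) (at c)"
    and meas: "F' \<in> borel_measurable M"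
  shows "((\<lambda>w. \<integral>z. F z w \<partial>M) has_real_derivative (\<integral>z. F' z \<partial>M)) (at c)"
proof -
  have "((\<lambda>y. ((\<integral>z. F z y \<partial>M) - (\<integral>z. F z c \<partial>M)) / (y - c)) \<longlongrightarrow> (\<integral>z. F' z \<partial>M))
      (at c within {a<..<b})"
    unfolding tendsto_at_iff_sequentially
  proof (intro allI impI)
    fix X :: "nat \<Rightarrow> real"
    assume X: "\<forall>i. X i \<in> {a<..<b} - {c}" and lim: "X \<longlonglongrightarrow> c"
    have int: "integrable M (\<lambda>z. (F z w - F z c) / (w - c))" if "w \<in> {a..b}" for w
      using integrable[OF that] integrable[of c] c by auto
    have X_in: "X i \<in> {a..b}" for i
      using X by (meson DiffD1 greaterThanLessThan_subseteq_atLeastAtMost_iff order_refl subsetD)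
    have "(\<lambda>i. \<integral>z. (F z (X i) - F z c) / (X i - c) \<partial>M) \<longlonglongrightarrow> (\<integral>z. F' z \<partial>M)"
    proof (rule integral_dominated_convergence)
      show "integrable M (\<lambda>z. \<bar>(F z a - F z c) / (a - c)\<bar> + \<bar>(F z b - F z c) / (b - c)\<bar>)"
        using c by (intro Bochner_Integration.integrable_add integrable_abs int[of a] int[of b]) auto
      show "(\<lambda>z. (F z (X i) - F z c) / (X i - c)) \<in> borel_measurable M" for i
        using int[OF X_in] by (rule borel_measurable_integrable)
      show "AE z in M. (\<lambda>i. (F z (X i) - F z c) / (X i - c)) \<longlonglongrightarrow> F' z"
      proof (rule AE_I2)
        fix z
        have "((\<lambda>y. (F z y - F z c) / (y - c)) \<longlongrightarrow> F' z) (at c)"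
          using deriv[of z] by (simp add: has_field_derivative_iff)
        then show "(\<lambda>i. (F z (X i) - F z c) / (X i - c)) \<longlonglongrightarrow> F' z"
          using X lim unfolding tendsto_at_iff_sequentially comp_def by blast
      qed
      show "AE z in M. norm ((F z (X i) - F z c) / (X i - c))
          \<le> \<bar>(F z a - F z c) / (a - c)\<bar> + \<bar>(F z b - F z c) / (b - c)\<bar>" for i
        unfolding real_norm_def
        using X c by (intro AE_I2 convex_on_abs_slope_le[OF convex]) auto
    qed (use meas in simp)
    moreover have "(\<integral>z. (F z (X i) - F z c) / (X i - c) \<partial>M)
        = ((\<integral>z. F z (X i) \<partial>M) - (\<integral>z. F z c \<partial>M)) / (X i - c)" for i
      using integrable[OF X_in[of i]] integrable[of c] c by simp
    ultimately show "((\<lambda>y. ((\<integral>z. F z y \<partial>M) - (\<integral>z. F z c \<partial>M)) / (y - c)) \<circ> X)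
        \<longlonglongrightarrow> (\<integral>z. F' z \<partial>M)"
      by (simp only: comp_def)
  qed
  then show ?thesis
    using c at_within_open[of c "{a<..<b}"] by (simp add: has_field_derivative_iff)
qed

subsection \<open>The logistic loss\<close>

lemma logistic_loss_eq: "logistic_loss t y = ln (1 + exp (- (y * t)))"
  by (simp add: logistic_loss_def sigmoid_def ln_div add_pos_pos)

lemma sigmoid_mono: "t \<le> u \<Longrightarrow> sigmoid t \<le> sigmoid u"
  by (auto simp: sigmoid_def add_pos_pos intro!: divide_left_mono)

lemma has_real_derivative_logistic_loss:
  "((\<lambda>t. logistic_loss t y) has_real_derivative - ((1 - sigmoid (y * t)) * y)) (at t)"
proof -
  have "1 + exp (- (y * t)) > 0"
    by (simp add: add_pos_pos)
  then show ?thesis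
    unfolding logistic_loss_eq sigmoid_def
    by (auto intro!: derivative_eq_intros simp: field_simps)
qed

lemma has_real_derivative_logistic_loss_scaled:
  "((\<lambda>w. logistic_loss (w * t) y) has_real_derivative
     - ((1 - sigmoid (y * (w * t))) * (y * t))) (at w)"
  using DERIV_chain2[OF has_real_derivative_logistic_loss[of y "w * t"]
      DERIV_cmult_right[OF DERIV_ident, of t]]
  by (simp add: mult.assoc)

text \<open>The derivative in \<open>w\<close> is increasing. If \<open>y * t\<close> is negative,
  the argument of the sigmoid decreases in \<open>w\<close>, but the factor \<open>y * t\<close>
  reverses the inequality once more.\<close>

lemma convex_on_logistic_loss_scaled: "convex_on {a..b} (\<lambda>w. logistic_loss (w * t) y)"
proof (rule convex_on_realI)
  fix w v :: real
  assume "w \<le> v"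
  then have "sigmoid (y * (w * t)) * (y * t) \<le> sigmoid (y * (v * t)) * (y * t)"
  proof (cases "0 \<le> y * t")
    case True
    then have "y * (w * t) \<le> y * (v * t)"
      using mult_left_mono[OF \<open>w \<le> v\<close> True] by (simp add: mult_ac)
    then show ?thesis
      using True by (intro mult_right_mono sigmoid_mono)
  next
    case False
    then have "y * (v * t) \<le> y * (w * t)"
      using mult_left_mono_neg[OF \<open>w \<le> v\<close>, of "y * t"] by (simp add: mult_ac)
    then show ?thesis
      using False by (intro mult_right_mono_neg sigmoid_mono) auto
  qed
  then show "- ((1 - sigmoid (y * (w * t))) * (y * t)) \<le> - ((1 - sigmoid (y * (v * t))) * (y * t))"
    by (simp add: algebra_simps)
qed (use has_real_derivative_logistic_loss_scaled in auto)

subsection \<open>The gradient of the network at a regular sample\<close>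

text \<open>Justifies the definite description in \<open>gradient\<close>; it also forces the
  gradient of a locally constant pre-activation to be \<open>0\<close>.\<close>

lemma GDERIV_unique:
  assumes "GDERIV f x :> D" "GDERIV f x :> E"
  shows "D = E"
  using has_derivative_unique[OF assms[unfolded gderiv_def]]
  by (metis inner_commute vector_eq_rdot)

lemma gradient_eqI: "GDERIV f x :> D \<Longrightarrow> gradient f x = D"
  unfolding gradient_def by (blast intro: GDERIV_unique)

lemma GDERIV_transform_eventually:
  assumes "GDERIV f x :> D" and ev: "\<forall>\<^sub>F x' in nhds x. f x' = g x'"
  shows "GDERIV g x :> D"
  using assms(1) unfolding gderiv_def
  by (rule has_derivative_transform_eventually)
    (use filter_leD[OF at_within_le_nhds ev] eventually_nhds_x_imp_x[OF ev] in auto)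

lemma GDERIV_sum:
  assumes "\<And>i. i \<in> A \<Longrightarrow> GDERIV (f i) x :> D i"
  shows "GDERIV (\<lambda>x. \<Sum>i\<in>A. f i x) x :> (\<Sum>i\<in>A. D i)"
  using assms unfolding gderiv_def inner_sum_right by (intro has_derivative_sum)

lemma GDERIV_cmult: "GDERIV f x :> D \<Longrightarrow> GDERIV (\<lambda>x. k * f x) x :> k *\<^sub>R D"
  using GDERIV_mult[OF GDERIV_const] by fastforce

text \<open>Where the activation is differentiable this is the chain rule, the slope being the
  derivative. Otherwise the neuron is locally constant before and after activation, and both sides
  are \<open>0\<close> whatever slope is chosen at the kink.\<close>

lemma GDERIV_act:
  assumes slopes: "activation_slopes N s" and regular: "regular_sample N x"
    and "l \<le> depth N" "i < width N l"
    and preact: "GDERIV (\<lambda>x. preact N l x i) x :> D"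
  shows "GDERIV (\<lambda>x. act N l (preact N l x i)) x :> s l (preact N l x i) *\<^sub>R D"
proof -
  consider "act N l differentiable (at (preact N l x i))"
    | "\<forall>\<^sub>F x' in nhds x. preact N l x' i = preact N l x i"
    using regular \<open>l \<le> depth N\<close> \<open>i < width N l\<close> unfolding regular_sample_def by blast
  then show ?thesis
  proof cases
    case 1
    then obtain k where k: "(act N l has_real_derivative k) (at (preact N l x i))"
      by (auto simp: real_differentiable_def)
    then have "s l (preact N l x i) = k"
      using slopes \<open>l \<le> depth N\<close> unfolding activation_slopes_def by blast
    then show ?thesis
      using GDERIV_DERIV_compose[OF preact k] by simp
  next
    case 2
    have "GDERIV (\<lambda>x. preact N l x i) x :> 0"
      by (rule GDERIV_transform_eventually[OF GDERIV_const[of "preact N l x i"]])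
        (use 2 in \<open>simp add: eq_commute\<close>)
    then have "D = 0"
      by (rule GDERIV_unique[OF preact])
    moreover have "GDERIV (\<lambda>x. act N l (preact N l x i)) x :> 0"
      by (rule GDERIV_transform_eventually[OF GDERIV_const[of "act N l (preact N l x i)"]])
        (use 2 in \<open>auto elim: eventually_mono\<close>)
    ultimately show ?thesis by simp
  qed
qed

text \<open>Induction over the layers: the recursion of \<open>pre_mat\<close> is the chain rule
  with the slopes in place of derivatives.\<close>

lemma GDERIV_preact:
  assumes "activation_slopes N s" "regular_sample N x" "l \<le> depth N" "i < width N l"
  shows "GDERIV (\<lambda>x. preact N l x i) x :> pre_mat N s l x i"
  using assms(3,4)
proof (induction l arbitrary: i)
  case 0
  have "GDERIV (\<lambda>x. in_weight N i \<bullet> x) x :> in_weight N i"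
    unfolding gderiv_def by (auto intro!: derivative_eq_intros simp: inner_commute)
  from GDERIV_add[OF this GDERIV_const] show ?case
    by simp
next
  case (Suc l)
  have "GDERIV (\<lambda>x. \<Sum>j<width N l. weight N l i j * act N l (preact N l x j)) x :>
      (\<Sum>j<width N l. weight N l i j *\<^sub>R (s l (preact N l x j) *\<^sub>R pre_mat N s l x j))"
    using Suc by (intro GDERIV_sum GDERIV_cmult GDERIV_act assms(1,2)) auto
  from GDERIV_add[OF this GDERIV_const] show ?case
    by simp
qed

lemma GDERIV_logit:
  assumes "activation_slopes N s" "regular_sample N x"
  shows "GDERIV (logit N \<beta>) x :> logit_row N s \<beta> x"
  unfolding logit_def[abs_def] rep_def logit_row_def rep_mat_def
  using assms by (intro GDERIV_sum GDERIV_cmult GDERIV_act GDERIV_preact) auto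

lemma gradient_logistic_loss_logit:
  assumes "activation_slopes N s" "regular_sample N x"
  shows "gradient (\<lambda>x'. logistic_loss (logit N \<beta> x') y) x = - Lvec N s \<beta> x y"
  using GDERIV_DERIV_compose[OF GDERIV_logit[OF assms]
      has_real_derivative_logistic_loss[of y], THEN gradient_eqI]
  by (simp add: Lvec_def sample_weight_def logit_affine[of N \<beta> x s])

text \<open>The affine form reproduces the logit at \<open>x\<close> itself, so the common factor
  \<open>sample_weight * y\<close> can be pulled out. The right side is minus the
  \<open>w\<close>-derivative of the loss at \<open>w = 1\<close>.\<close>

lemma Lvec_inner_add_Bconst:
  "Lvec N s \<beta> x y \<bullet> x + Bconst N s \<beta> x y
    = (1 - sigmoid (y * logit N \<beta> x)) * (y * logit N \<beta> x)"
  unfolding logit_affine[of N \<beta> x s]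
  by (simp add: Lvec_def Bconst_def sample_weight_def algebra_simps)

subsection \<open>Measurability\<close>

lemma borel_measurable_preact:
  assumes "\<And>k. k \<le> depth N \<Longrightarrow> act N k \<in> borel_measurable borel" "l \<le> depth N"
  shows "(\<lambda>x. preact N l x i) \<in> borel_measurable borel"
  using assms(2)
proof (induction l arbitrary: i)
  case (Suc l)
  then have [measurable]: "(\<lambda>x. preact N l x j) \<in> borel_measurable borel" for j
    by simp
  have [measurable]: "act N l \<in> borel_measurable borel"
    using Suc.prems by (intro assms(1)) simp
  show ?case by simp
qed simp

text \<open>The rows vary with \<open>x\<close> only through the slopes at the pre-activations,
  hence the measurability of each \<open>s k\<close>.\<close>

lemma borel_measurable_pre_mat:
  assumes "\<And>k. k \<le> depth N \<Longrightarrow> act N k \<in> borel_measurable borel"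
    and "\<And>k. k \<le> depth N \<Longrightarrow> s k \<in> borel_measurable borel" and "l \<le> depth N"
  shows "(\<lambda>x. pre_mat N s l x i) \<in> borel_measurable borel"
  using assms(3)
proof (induction l arbitrary: i)
  case (Suc l)
  then have [measurable]: "(\<lambda>x. pre_mat N s l x j) \<in> borel_measurable borel" for j
    by simp
  have [measurable]: "s l \<in> borel_measurable borel"
    using Suc.prems by (intro assms(2)) simp
  have [measurable]: "(\<lambda>x. preact N l x j) \<in> borel_measurable borel" for j
    using Suc.prems by (intro borel_measurable_preact assms(1)) simp_all
  show ?case by simp
qed simp

lemma borel_measurable_logit:
  assumes "\<And>k. k \<le> depth N \<Longrightarrow> act N k \<in> borel_measurable borel"
  shows "logit N \<beta> \<in> borel_measurable borel"
proof -
  have [measurable]: "act N (depth N) \<in> borel_measurable borel"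
    "(\<lambda>x. preact N (depth N) x j) \<in> borel_measurable borel" for j
    by (simp_all add: borel_measurable_preact assms)
  show ?thesis
    unfolding logit_def[abs_def] rep_def by measurable
qed

lemma borel_measurable_logit_row:
  assumes "\<And>k. k \<le> depth N \<Longrightarrow> act N k \<in> borel_measurable borel"
    and "\<And>k. k \<le> depth N \<Longrightarrow> s k \<in> borel_measurable borel"
  shows "logit_row N s \<beta> \<in> borel_measurable borel"
proof -
  have [measurable]: "s (depth N) \<in> borel_measurable borel"
    "(\<lambda>x. preact N (depth N) x j) \<in> borel_measurable borel"
    "(\<lambda>x. pre_mat N s (depth N) x j) \<in> borel_measurable borel" for j
    by (simp_all add: borel_measurable_preact borel_measurable_pre_mat assms)
  show ?thesis
    unfolding logit_row_def[abs_def] rep_mat_def by measurable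
qed

lemma borel_measurable_sigmoid [measurable]: "sigmoid \<in> borel_measurable borel"
  unfolding sigmoid_def[abs_def] by measurable

section \<open>The two penalty identities on an environment\<close>

theorem proposition3p1:
  fixes \<E> :: "'e set"
    and D :: "'e \<Rightarrow> ((real ^ ('n::finite)) \<times> real) measure"
    and N :: "'n network"
    and s :: "nat \<Rightarrow> real \<Rightarrow> real"
    and \<beta> :: "nat \<Rightarrow> real"
  assumes distr: "\<And>e. e \<in> \<E> \<Longrightarrow> prob_space (D e)"
    and sets_D: "\<And>e. e \<in> \<E> \<Longrightarrow> sets (D e) = sets borel"
    and labels: "\<And>e. e \<in> \<E> \<Longrightarrow> AE (x, y) in D e. y \<in> {-1, 1}"
    and act_meas: "\<And>l. l \<le> depth N \<Longrightarrow> act N l \<in> borel_measurable borel"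
    and slope_meas: "\<And>l. l \<le> depth N \<Longrightarrow> s l \<in> borel_measurable borel"
    and slopes: "activation_slopes N s"
    and regular: "\<And>e. e \<in> \<E> \<Longrightarrow> AE (x, y) in D e. regular_sample N x"
    and risk_finite: "\<And>e. e \<in> \<E> \<Longrightarrow>
      \<forall>\<^sub>F w in nhds 1. integrable (D e) (\<lambda>(x, y). logistic_loss (w * logit N \<beta> x) y)"
    and grad_integrable: "\<And>e. e \<in> \<E> \<Longrightarrow>
      integrable (D e) (\<lambda>(x, y). gradient (\<lambda>x'. logistic_loss (logit N \<beta> x') y) x)"
  shows "\<forall>e\<in>\<E>.
    penalty_IRM (D e) (logit N \<beta>)
      = (norm (\<integral>(x, y). Lvec N s \<beta> x y \<bullet> x + Bconst N s \<beta> x y \<partial>D e))\<^sup>2 \<and>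
    penalty_DAT (D e) (logit N \<beta>) = norm (\<integral>(x, y). Lvec N s \<beta> x y \<partial>D e)"
proof (intro ballI conjI)
  fix e
  assume e: "e \<in> \<E>"
  \<comment> \<open>The product form of the Borel sets lets measurability of functions of pairs be
    derived from their components.\<close>
  have [measurable_cong]: "sets (D e) = sets (borel \<Otimes>\<^sub>M borel)"
    using sets_D[OF e] by (simp only: borel_prod)
  have [measurable]: "logit N \<beta> \<in> borel_measurable borel"
    "logit_row N s \<beta> \<in> borel_measurable borel"
    by (simp_all add: borel_measurable_logit borel_measurable_logit_row act_meas slope_meas)
  define G where "G = (\<lambda>(x, y). (1 - sigmoid (y * logit N \<beta> x)) * (y * logit N \<beta> x))"
  have [measurable]: "G \<in> borel_measurable (D e)"
    unfolding G_def by measurable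
  \<comment> \<open>Folding the affine form back into \<open>logit\<close> avoids a separate
    measurability argument for \<open>logit_const\<close>.\<close>
  have "(\<lambda>(x, y). Lvec N s \<beta> x y) \<in> borel_measurable (D e)"
    unfolding Lvec_def sample_weight_def logit_affine[symmetric] by measurable
  moreover have "AE z in D e. (case z of (x, y) \<Rightarrow>
      gradient (\<lambda>x'. logistic_loss (logit N \<beta> x') y) x) = - (case z of (x, y) \<Rightarrow> Lvec N s \<beta> x y)"
    using regular[OF e] by eventually_elim (auto simp: gradient_logistic_loss_logit[OF slopes])
  \<comment> \<open>The integrands agree only almost everywhere, so both must be measurable; for the
    gradient this comes from its assumed integrability.\<close>
  ultimately have "(\<integral>(x, y). gradient (\<lambda>x'. logistic_loss (logit N \<beta> x') y) x \<partial>D e)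
      = (\<integral>z. - (case z of (x, y) \<Rightarrow> Lvec N s \<beta> x y) \<partial>D e)"
    using grad_integrable[OF e] by (intro integral_cong_AE) auto
  then show "penalty_DAT (D e) (logit N \<beta>) = norm (\<integral>(x, y). Lvec N s \<beta> x y \<partial>D e)"
    by (simp add: penalty_DAT_def)

  obtain r where "r > 0" and r: "\<And>w. dist w 1 < r \<Longrightarrow>
      integrable (D e) (\<lambda>(x, y). logistic_loss (w * logit N \<beta> x) y)"
    using risk_finite[OF e] unfolding eventually_nhds_metric by blast
  have "((\<lambda>w. \<integral>z. logistic_loss (w * logit N \<beta> (fst z)) (snd z) \<partial>D e)
      has_real_derivative (\<integral>z. - G z \<partial>D e)) (at 1)"
  proof (rule has_real_derivative_integral_convex)
    \<comment> \<open>Half the radius keeps the closed interval inside the open ball on which the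
      scaled loss is integrable.\<close>
    show "1 - r / 2 < 1" "1 < 1 + r / 2"
      using \<open>r > 0\<close> by auto
    show "integrable (D e) (\<lambda>z. logistic_loss (w * logit N \<beta> (fst z)) (snd z))"
      if "w \<in> {1 - r / 2..1 + r / 2}" for w
    proof -
      have "dist w 1 < r"
        using that \<open>r > 0\<close> by (auto simp: dist_real_def abs_if)
      then show ?thesis
        using r[of w] by (simp only: case_prod_beta')
    qed
    show "((\<lambda>w. logistic_loss (w * logit N \<beta> (fst z)) (snd z)) has_real_derivative - G z) (at 1)"
      for z
      using has_real_derivative_logistic_loss_scaled[of "logit N \<beta> (fst z)" "snd z" 1]
      by (simp add: G_def case_prod_beta)
  qed (simp_all add: convex_on_logistic_loss_scaled)
  then have "deriv (\<lambda>w. risk (D e) (\<lambda>x. w * logit N \<beta> x)) 1 = - (\<integral>z. G z \<partial>D e)"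
    unfolding risk_def case_prod_beta' by (simp add: DERIV_imp_deriv)
  then show "penalty_IRM (D e) (logit N \<beta>)
      = (norm (\<integral>(x, y). Lvec N s \<beta> x y \<bullet> x + Bconst N s \<beta> x y \<partial>D e))\<^sup>2"
    by (simp add: penalty_IRM_def G_def Lvec_inner_add_Bconst)
qed

end
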